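(* Let $A$ be a commutative ring with nonzero identity, let $M$ be an $A$-module and let $L\subseteq P$ be two submodules of $M$. Then $P$ is a classical 1-absorbing prime submodule of $M$ if and only if $P/L$ is a classical 1-absorbing prime submodule of $M/L$.
   Context: All rings are commutative with nonzero identity; the given module $M$ is nonzero and unital. A proper submodule $P$ of an $A$-module $M$ is a classical 1-absorbing prime submodule if whenever $abcm\in P$ for nonunits $a,b,c\in A$ and $m\in M$, then $abm\in P$ or $cm\in P$. *)

theory Defs
  imports "HOL-Algebra.Module" "HOL-Algebra.AbelCoset"
begin

text \<open>
  As in the library's quotient rings, the elements of \<open>M/L\<close> are the additive cosets
  \<open>L +> x\<close>. A module record extends a ring record, but its fields \<open>mult\<close> and \<open>one\<close> play no
  role for modules and are left unspecified.
\<close>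

definition FactModule :: "('a, 'b, 'm) module_scheme \<Rightarrow> 'b set \<Rightarrow> ('a, 'b set) module"
  where "FactModule M L =
    \<lparr>carrier = a_rcosets\<^bsub>M\<^esub> L, mult = undefined, one = undefined, zero = L, add = set_add M,
     smult = (\<lambda>a X. \<Union>x\<in>X. L +>\<^bsub>M\<^esub> (a \<odot>\<^bsub>M\<^esub> x))\<rparr>"

definition quotient_submodule :: "('a, 'b, 'm) module_scheme \<Rightarrow> 'b set \<Rightarrow> 'b set \<Rightarrow> 'b set set"
  where "quotient_submodule M P L = (\<lambda>p. L +>\<^bsub>M\<^esub> p) ` P"

definition classical_1_absorbing_prime_submodule ::
    "'b set \<Rightarrow> ('a, 'r) ring_scheme \<Rightarrow> ('a, 'b, 'm) module_scheme \<Rightarrow> bool"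
  where "classical_1_absorbing_prime_submodule P A M \<longleftrightarrow>
    submodule P A M \<and> P \<noteq> carrier M \<and>
    (\<forall>a \<in> carrier A - Units A. \<forall>b \<in> carrier A - Units A. \<forall>c \<in> carrier A - Units A.
      \<forall>m \<in> carrier M.
        (a \<otimes>\<^bsub>A\<^esub> b \<otimes>\<^bsub>A\<^esub> c) \<odot>\<^bsub>M\<^esub> m \<in> P \<longrightarrow>
        (a \<otimes>\<^bsub>A\<^esub> b) \<odot>\<^bsub>M\<^esub> m \<in> P \<or> c \<odot>\<^bsub>M\<^esub> m \<in> P)"

lemma carrier_FactModule: "carrier (FactModule M L) = (\<lambda>x. L +>\<^bsub>M\<^esub> x) ` carrier M"
  by (auto simp: FactModule_def A_RCOSETS_def')

lemma quotient_submodule_carrier: "quotient_submodule M (carrier M) L = carrier (FactModule M L)"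
  by (simp add: quotient_submodule_def carrier_FactModule)

context
  fixes A :: "('a, 'r) ring_scheme" and M :: "('a, 'b, 'm) module_scheme" and L
  assumes A_M: "module A M" and L: "submodule L A M"
begin

interpretation module A M by (rule A_M)

lemma abelian_subgroup_submodule: "abelian_subgroup L M"
  using L by (intro abelian_subgroupI3 additive_subgroup.intro)
    (auto simp: submodule_def M.abelian_group_axioms)

interpretation Q: abelian_subgroup L M by (rule abelian_subgroup_submodule)

lemma FactModule_add:
  assumes "x \<in> carrier M" "y \<in> carrier M"
  shows "(L +>\<^bsub>M\<^esub> x) \<oplus>\<^bsub>FactModule M L\<^esub> (L +>\<^bsub>M\<^esub> y) = L +>\<^bsub>M\<^esub> (x \<oplus>\<^bsub>M\<^esub> y)"
  using assms by (simp add: FactModule_def Q.a_rcos_sum)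

lemma FactModule_smult:
  assumes a: "a \<in> carrier A" and x: "x \<in> carrier M"
  shows "a \<odot>\<^bsub>FactModule M L\<^esub> (L +>\<^bsub>M\<^esub> x) = L +>\<^bsub>M\<^esub> (a \<odot>\<^bsub>M\<^esub> x)"
proof -
  have "L +>\<^bsub>M\<^esub> (a \<odot>\<^bsub>M\<^esub> y) = L +>\<^bsub>M\<^esub> (a \<odot>\<^bsub>M\<^esub> x)" if y: "y \<in> L +>\<^bsub>M\<^esub> x" for y
  proof -
    obtain h where h: "h \<in> L" "y = h \<oplus>\<^bsub>M\<^esub> x" using y by (auto simp: a_r_coset_def')
    have hM: "h \<in> carrier M" using h(1) Q.a_Hcarr by blast
    have ah: "a \<odot>\<^bsub>M\<^esub> h \<in> L" using submoduleE(4)[OF L] a h by blast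
    have "a \<odot>\<^bsub>M\<^esub> y = a \<odot>\<^bsub>M\<^esub> h \<oplus>\<^bsub>M\<^esub> a \<odot>\<^bsub>M\<^esub> x" using a x hM h(2) by (simp add: smult_r_distr)
    then have "a \<odot>\<^bsub>M\<^esub> y \<in> L +>\<^bsub>M\<^esub> (a \<odot>\<^bsub>M\<^esub> x)" using ah by (auto simp: a_r_coset_def')
    then show ?thesis using a x Q.a_repr_independence' by simp
  qed
  then have "(\<Union>y\<in>L +>\<^bsub>M\<^esub> x. L +>\<^bsub>M\<^esub> (a \<odot>\<^bsub>M\<^esub> y)) = L +>\<^bsub>M\<^esub> (a \<odot>\<^bsub>M\<^esub> x)"
    by (intro UN_constant_eq[OF Q.a_rcos_self[OF x]] ballI)
  then show ?thesis by (simp add: FactModule_def)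
qed

lemma zero_FactModule: "\<zero>\<^bsub>FactModule M L\<^esub> = L +>\<^bsub>M\<^esub> \<zero>\<^bsub>M\<^esub>"
  using M.a_coset_add_zero[OF Q.a_subset] by (simp add: FactModule_def)

lemma abelian_group_FactModule: "abelian_group (FactModule M L)"
proof (rule abelian_groupI)
  fix X assume "X \<in> carrier (FactModule M L)"
  then obtain x where x: "x \<in> carrier M" "X = L +>\<^bsub>M\<^esub> x"
    by (auto simp: carrier_FactModule)
  show "\<exists>Y \<in> carrier (FactModule M L). Y \<oplus>\<^bsub>FactModule M L\<^esub> X = \<zero>\<^bsub>FactModule M L\<^esub>"
  proof (rule bexI)
    show "(L +>\<^bsub>M\<^esub> \<ominus>\<^bsub>M\<^esub> x) \<oplus>\<^bsub>FactModule M L\<^esub> X = \<zero>\<^bsub>FactModule M L\<^esub>"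
      using x by (simp add: FactModule_add zero_FactModule M.l_neg)
    show "L +>\<^bsub>M\<^esub> \<ominus>\<^bsub>M\<^esub> x \<in> carrier (FactModule M L)"
      using x by (simp add: carrier_FactModule)
  qed
qed (auto simp: carrier_FactModule FactModule_add zero_FactModule M.a_ac)

lemma module_FactModule: "module A (FactModule M L)"
proof (rule moduleI)
  fix a b X assume a: "a \<in> carrier A" and b: "b \<in> carrier A" and "X \<in> carrier (FactModule M L)"
  then obtain x where x: "x \<in> carrier M" "X = L +>\<^bsub>M\<^esub> x"
    by (auto simp: carrier_FactModule)
  show "(a \<oplus>\<^bsub>A\<^esub> b) \<odot>\<^bsub>FactModule M L\<^esub> X =
      a \<odot>\<^bsub>FactModule M L\<^esub> X \<oplus>\<^bsub>FactModule M L\<^esub> b \<odot>\<^bsub>FactModule M L\<^esub> X"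
    using a b x by (simp add: FactModule_add FactModule_smult smult_l_distr)
  show "(a \<otimes>\<^bsub>A\<^esub> b) \<odot>\<^bsub>FactModule M L\<^esub> X =
      a \<odot>\<^bsub>FactModule M L\<^esub> (b \<odot>\<^bsub>FactModule M L\<^esub> X)"
    using a b x by (simp add: FactModule_smult smult_assoc1)
next
  fix a X Y assume a: "a \<in> carrier A"
    and "X \<in> carrier (FactModule M L)" "Y \<in> carrier (FactModule M L)"
  then obtain x y where xy: "x \<in> carrier M" "X = L +>\<^bsub>M\<^esub> x" "y \<in> carrier M" "Y = L +>\<^bsub>M\<^esub> y"
    by (auto simp: carrier_FactModule)
  show "a \<odot>\<^bsub>FactModule M L\<^esub> (X \<oplus>\<^bsub>FactModule M L\<^esub> Y) =
      a \<odot>\<^bsub>FactModule M L\<^esub> X \<oplus>\<^bsub>FactModule M L\<^esub> a \<odot>\<^bsub>FactModule M L\<^esub> Y"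
    using a xy by (simp add: FactModule_add FactModule_smult smult_r_distr)
next
  fix a X assume a: "a \<in> carrier A" and "X \<in> carrier (FactModule M L)"
  then obtain x where x: "x \<in> carrier M" "X = L +>\<^bsub>M\<^esub> x"
    by (auto simp: carrier_FactModule)
  show "a \<odot>\<^bsub>FactModule M L\<^esub> X \<in> carrier (FactModule M L)"
    using a x by (simp add: FactModule_smult carrier_FactModule)
next
  fix X assume "X \<in> carrier (FactModule M L)"
  then obtain x where x: "x \<in> carrier M" "X = L +>\<^bsub>M\<^esub> x"
    by (auto simp: carrier_FactModule)
  show "\<one>\<^bsub>A\<^esub> \<odot>\<^bsub>FactModule M L\<^esub> X = X"
    using x by (simp add: FactModule_smult)
qed (rule R.is_cring abelian_group_FactModule)+

end

end

theory Submission
  imports Defs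
begin

text \<open>
  The projection \<open>x \<mapsto> L +> x\<close> maps \<open>M\<close> onto \<open>M/L\<close> and commutes with scalar multiplication, and
  since \<open>L \<subseteq> P\<close> the submodule \<open>P\<close> is a union of cosets of \<open>L\<close>: a coset \<open>L +> x\<close> belongs to \<open>P/L\<close>
  exactly when \<open>x\<close> belongs to \<open>P\<close> (\<open>coset_in_quotient_submodule_iff\<close>). Hence each membership in
  the absorbing condition holds for \<open>x\<close> and \<open>P\<close> exactly when it holds for \<open>L +> x\<close> and \<open>P/L\<close>, and
  as every element of \<open>M/L\<close> is such a coset, the two absorbing conditions say the same. The same
  equivalence shows that \<open>P\<close> is proper if and only if \<open>P/L\<close> is.
\<close>

context
  fixes A :: "('a, 'r) ring_scheme" and M :: "('a, 'b, 'm) module_scheme" and L P :: "'b set"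
  assumes A_M: "module A M" and L: "submodule L A M" and P: "submodule P A M"
begin

interpretation module A M by (rule A_M)

interpretation Q: module A "FactModule M L" by (rule module_FactModule[OF A_M L])

interpretation S: abelian_subgroup L M by (rule abelian_subgroup_submodule[OF A_M L])

lemma submodule_quotient_submodule: "submodule (quotient_submodule M P L) A (FactModule M L)"
proof (rule Q.submoduleI)
  note P_subset = submoduleE(1)[OF P]
  show "quotient_submodule M P L \<subseteq> carrier (FactModule M L)"
    using P_subset by (auto simp: quotient_submodule_def carrier_FactModule)
  have "\<zero>\<^bsub>M\<^esub> \<in> P" using subgroup.one_closed[OF submodule.axioms(1)[OF P]] by simp
  then show "\<zero>\<^bsub>FactModule M L\<^esub> \<in> quotient_submodule M P L"
    by (auto simp: quotient_submodule_def zero_FactModule[OF A_M L])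
  show "\<ominus>\<^bsub>FactModule M L\<^esub> X \<in> quotient_submodule M P L" if X: "X \<in> quotient_submodule M P L" for X
  proof -
    obtain p where p: "p \<in> P" "X = L +>\<^bsub>M\<^esub> p" using X by (auto simp: quotient_submodule_def)
    have pM: "p \<in> carrier M" using p(1) P_subset by blast
    have "\<ominus>\<^bsub>FactModule M L\<^esub> X = L +>\<^bsub>M\<^esub> \<ominus>\<^bsub>M\<^esub> p"
      using pM p(2)
      by (intro Q.M.minus_equality)
        (auto simp: FactModule_add[OF A_M L] zero_FactModule[OF A_M L] carrier_FactModule M.l_neg)
    then show ?thesis using submoduleE(3)[OF P p(1)] by (simp add: quotient_submodule_def)
  qed
  show "X \<oplus>\<^bsub>FactModule M L\<^esub> Y \<in> quotient_submodule M P L"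
    if "X \<in> quotient_submodule M P L" "Y \<in> quotient_submodule M P L" for X Y
    using that P_subset submoduleE(5)[OF P]
    by (auto simp: quotient_submodule_def FactModule_add[OF A_M L] subset_iff)
  show "a \<odot>\<^bsub>FactModule M L\<^esub> X \<in> quotient_submodule M P L"
    if "a \<in> carrier A" "X \<in> quotient_submodule M P L" for a X
    using that P_subset submoduleE(4)[OF P]
    by (auto simp: quotient_submodule_def FactModule_smult[OF A_M L] subset_iff)
qed

text \<open>
  If \<open>L +> x = L +> p\<close> with \<open>p \<in> P\<close>, then \<open>x\<close> differs from \<open>p\<close> by an element of \<open>L \<subseteq> P\<close>, so it lies
  in \<open>P\<close> as well.
\<close>

lemma coset_in_quotient_submodule_iff:
  assumes LP: "L \<subseteq> P" and x: "x \<in> carrier M"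
  shows "L +>\<^bsub>M\<^esub> x \<in> quotient_submodule M P L \<longleftrightarrow> x \<in> P"
proof
  assume "L +>\<^bsub>M\<^esub> x \<in> quotient_submodule M P L"
  then obtain p where p: "p \<in> P" "L +>\<^bsub>M\<^esub> x = L +>\<^bsub>M\<^esub> p"
    by (auto simp: quotient_submodule_def)
  have "x \<in> L +>\<^bsub>M\<^esub> p" using S.a_rcos_self[OF x] p(2) by simp
  then obtain h where "h \<in> L" "x = h \<oplus>\<^bsub>M\<^esub> p" by (auto simp: a_r_coset_def')
  then show "x \<in> P" using p(1) LP submoduleE(5)[OF P] by blast
qed (simp add: quotient_submodule_def)

lemma quotient_submodule_proper_iff:
  assumes LP: "L \<subseteq> P"
  shows "quotient_submodule M P L \<noteq> carrier (FactModule M L) \<longleftrightarrow> P \<noteq> carrier M"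
proof -
  have "P = carrier M" if "quotient_submodule M P L = carrier (FactModule M L)"
  proof
    show "P \<subseteq> carrier M" by (rule submoduleE(1)[OF P])
    show "carrier M \<subseteq> P"
      using that coset_in_quotient_submodule_iff[OF LP] by (auto simp: carrier_FactModule)
  qed
  then show ?thesis using quotient_submodule_carrier by metis
qed

lemma absorbing_quotient_submodule_iff:
  assumes LP: "L \<subseteq> P" and abc: "a \<in> carrier A" "b \<in> carrier A" "c \<in> carrier A"
  shows "(\<forall>X \<in> carrier (FactModule M L).
        (a \<otimes>\<^bsub>A\<^esub> b \<otimes>\<^bsub>A\<^esub> c) \<odot>\<^bsub>FactModule M L\<^esub> X \<in> quotient_submodule M P L \<longrightarrow>
        (a \<otimes>\<^bsub>A\<^esub> b) \<odot>\<^bsub>FactModule M L\<^esub> X \<in> quotient_submodule M P L \<or>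
        c \<odot>\<^bsub>FactModule M L\<^esub> X \<in> quotient_submodule M P L) \<longleftrightarrow>
      (\<forall>m \<in> carrier M.
        (a \<otimes>\<^bsub>A\<^esub> b \<otimes>\<^bsub>A\<^esub> c) \<odot>\<^bsub>M\<^esub> m \<in> P \<longrightarrow>
        (a \<otimes>\<^bsub>A\<^esub> b) \<odot>\<^bsub>M\<^esub> m \<in> P \<or> c \<odot>\<^bsub>M\<^esub> m \<in> P)"
proof -
  have "r \<odot>\<^bsub>FactModule M L\<^esub> (L +>\<^bsub>M\<^esub> m) \<in> quotient_submodule M P L \<longleftrightarrow> r \<odot>\<^bsub>M\<^esub> m \<in> P"
    if "r \<in> carrier A" "m \<in> carrier M" for r m
    using that by (simp add: FactModule_smult[OF A_M L] coset_in_quotient_submodule_iff[OF LP])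
  then show ?thesis using abc by (simp add: carrier_FactModule)
qed

end

theorem corollary1:
  fixes A :: "('a, 'r) ring_scheme" and M :: "('a, 'b, 'm) module_scheme"
    and L P :: "'b set"
  assumes "module A M"
    and "\<one>\<^bsub>A\<^esub> \<noteq> \<zero>\<^bsub>A\<^esub>"
    and "carrier M \<noteq> {\<zero>\<^bsub>M\<^esub>}"
    and "submodule L A M"
    and "submodule P A M"
    and "L \<subseteq> P"
  shows "classical_1_absorbing_prime_submodule P A M \<longleftrightarrow>
    classical_1_absorbing_prime_submodule (quotient_submodule M P L) A (FactModule M L)"
proof -
  note facts = assms(1,4,5)
  show ?thesis
    unfolding classical_1_absorbing_prime_submodule_def
    using assms(5) submodule_quotient_submodule[OF facts]
      quotient_submodule_proper_iff[OF facts assms(6)]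
      absorbing_quotient_submodule_iff[OF facts assms(6)]
    by simp
qed

end
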